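(* Let $G\in\mathbb{Np}^\infty$ be any form and let $H\in\mathbb{Np}^\infty$ be a Conway game. Then $G\succcurlyeq H$ if and only if $o(G+\overline{H})\in\{\mathscr L,\mathscr P\}$, and $G=H$ if and only if $o(G+\overline{H})=\mathscr P$.
   Context: Affine normal play forms $\mathbb{Np}^\infty$ are defined recursively: two atomic forms $\infty$ and $\overline{\infty}$ with no options; every other form is $G=\{G^{\mathcal L}\mid G^{\mathcal R}\}$ with finite nonempty sets of previously constructed forms as Left and Right options. Followers of $G$: $G$ and followers of its options. Disjunctive sum: $\infty+X=X+\infty=\infty$ for $X\neq\overline{\infty}$; $\overline{\infty}+X=X+\overline{\infty}=\overline{\infty}$ for $X\ne\infty$; $\infty+\overline{\infty}$ undefined; otherwise $G+H=\{G^L+H,G+H^L\mid G^R+H,G+H^R\}$. Outcomes: Left wins $\infty$ and Right wins $\overline{\infty}$ whoever moves; otherwise play alternates, Left moving first wins iff some Left option is won by Left moving second, Left moving second wins iff every Right option is won by Left moving first, symmetrically for Right. $o(G)\in\{\mathscr L,\mathscr N,\mathscr P,\mathscr R\}$ (Left wins either way, first player wins, second player wins, Right wins either way), ordered $\mathscr L>\mathscr N,\mathscr P>\mathscr R$ with $\mathscr N,\mathscr P$ incomparable. $G\succcurlyeq H$ means $o(G+X)\geqslant o(H+X)$ for all $X\in\mathbb{Np}^\infty\setminus\{\infty,\overline\infty\}$; $G=H$ means both directions. Conjugate $\overline H$: $\overline\infty$ if $H=\infty$, $\infty$ if $H=\overline\infty$, otherwise $\{\overline{H^R}\mid\overline{H^L}\}$.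 A form $G\notin\{\infty,\overline\infty\}$ is a check if $\infty\in G^{\mathcal L}$ or $\overline\infty\in G^{\mathcal R}$. A Conway form is a form not in $\{\infty,\overline\infty\}$ none of whose followers is a check; a Conway game is a form equal to some Conway form. *)

theory Defs
  imports Main "HOL-Library.FSet"
begin

text \<open>The datatype also contains trees with an empty set of options at a non-atomic position;
  \<open>Np\<close> singles out the genuine affine normal play forms.\<close>

datatype form = PosInf (\<open>\<infinity>\<close>) | NegInf (\<open>-\<infinity>\<close>) | Form "form fset" "form fset"

inductive_set Np :: "form set" where
  PosInf: "\<infinity> \<in> Np"
| NegInf: "-\<infinity> \<in> Np"
| Form: "\<lbrakk>L \<noteq> {||}; R \<noteq> {||}; \<And>x. x |\<in>| L \<Longrightarrow> x \<in> Np; \<And>x. x |\<in>| R \<Longrightarrow> x \<in> Np\<rbrakk>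
    \<Longrightarrow> Form L R \<in> Np"

datatype player = Left | Right

fun opponent :: "player \<Rightarrow> player" where
  "opponent Left = Right"
| "opponent Right = Left"

fun opts :: "player \<Rightarrow> form \<Rightarrow> form fset" where
  "opts Left (Form L R) = L"
| "opts Right (Form L R) = R"
| "opts p \<infinity> = {||}"
| "opts p -\<infinity> = {||}"

text \<open>\<open>follower F G\<close>: \<open>F\<close> is a follower of \<open>G\<close>.\<close>

inductive follower :: "form \<Rightarrow> form \<Rightarrow> bool" where
  refl: "follower G G"
| option: "G' |\<in>| opts p G \<Longrightarrow> follower F G' \<Longrightarrow> follower F G"

lemma size_option: "x |\<in>| A \<Longrightarrow> size x < size_fset size (A :: form fset)"
proof -
  assume "x |\<in>| A"
  then have "Suc (size x) \<le> (\<Sum>y \<in> fset A. Suc (size y))"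
    by (intro member_le_sum[where f = "\<lambda>y. Suc (size y)"]) auto
  then show ?thesis by simp
qed

lemma size_opts: "x |\<in>| opts p G \<Longrightarrow> size x < size G"
  by (cases p; cases G; simp del: size_fset_simps; drule size_option; linarith)

declare fimage_cong [fundef_cong]

text \<open>The sum of the two different atoms is undefined. It is left unspecified here: the equations
  never refer to it in the recursion, since one of the two summands there is always non-atomic.\<close>

function plus_form :: "form \<Rightarrow> form \<Rightarrow> form" (infixl \<open>\<oplus>\<close> 65) where
  "\<infinity> \<oplus> X = (if X = -\<infinity> then undefined else \<infinity>)"
| "-\<infinity> \<oplus> X = (if X = \<infinity> then undefined else -\<infinity>)"
| "Form L R \<oplus> \<infinity> = \<infinity>"
| "Form L R \<oplus> -\<infinity> = -\<infinity>"
| "Form GL GR \<oplus> Form HL HR =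
     Form ((\<lambda>G'. G' \<oplus> Form HL HR) |`| GL |\<union>| (\<lambda>H'. Form GL GR \<oplus> H') |`| HL)
          ((\<lambda>G'. G' \<oplus> Form HL HR) |`| GR |\<union>| (\<lambda>H'. Form GL GR \<oplus> H') |`| HR)"
  by pat_completeness auto
termination
  by (relation "measure (\<lambda>(G, H). size G + size H)")
     (simp_all only: wf_measure in_measure prod.case form.size, (drule size_option, linarith)+)

text \<open>\<open>wins p q G\<close>: player \<open>p\<close> wins \<open>G\<close> when player \<open>q\<close> is to move.\<close>

function wins :: "player \<Rightarrow> player \<Rightarrow> form \<Rightarrow> bool" where
  "wins p q \<infinity> \<longleftrightarrow> p = Left"
| "wins p q -\<infinity> \<longleftrightarrow> p = Right"
| "wins p q (Form L R) \<longleftrightarrow>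
     (if q = p then \<exists>G' |\<in>| opts q (Form L R). wins p (opponent q) G'
      else \<forall>G' |\<in>| opts q (Form L R). wins p (opponent q) G')"
  by pat_completeness auto
termination
  by (relation "measure (\<lambda>(p, q, G). size G)")
     (simp_all only: wf_measure in_measure prod.case size_opts)

lemma opponent_neq [simp]: "opponent p \<noteq> p" "p \<noteq> opponent p"
  by (cases p; simp)+

lemma wins_determined: "wins (opponent p) q G \<longleftrightarrow> \<not> wins p q G"
proof (induction p q G rule: wins.induct)
  case (3 p q L R)
  then show ?case
    by (cases p; cases q; simp)
next
  case (1 p q)
  show ?case by (cases p; simp)
next
  case (2 p q)
  show ?case by (cases p; simp)
qed

datatype outcome = OL | ON | OP | OR

instantiation outcome :: order
begin

definition less_eq_outcome :: "outcome \<Rightarrow> outcome \<Rightarrow> bool" where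
  "a \<le> b \<longleftrightarrow> a = b \<or> a = OR \<or> b = OL"

definition less_outcome :: "outcome \<Rightarrow> outcome \<Rightarrow> bool" where
  "a < b \<longleftrightarrow> a \<le> b \<and> a \<noteq> (b :: outcome)"

instance
  by standard (auto simp: less_eq_outcome_def less_outcome_def)

end

text \<open>By \<open>wins_determined\<close>, exactly one of the four cases applies, the last one being that
  Right wins whoever moves first.\<close>

definition outcome :: "form \<Rightarrow> outcome" where
  "outcome G =
     (if wins Left Left G \<and> wins Left Right G then OL
      else if wins Left Left G \<and> wins Right Right G then ON
      else if wins Right Left G \<and> wins Left Right G then OP
      else OR)"

definition geq_form :: "form \<Rightarrow> form \<Rightarrow> bool" (infix \<open>\<succeq>\<close> 50) where
  "G \<succeq> H \<longleftrightarrow> (\<forall>X \<in> Np - {\<infinity>, -\<infinity>}. outcome (G \<oplus> X) \<ge> outcome (H \<oplus> X))"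

text \<open>Equality of forms in the sense of games, as opposed to identity \<open>=\<close>.\<close>

definition eq_form :: "form \<Rightarrow> form \<Rightarrow> bool" (infix \<open>\<doteq>\<close> 50) where
  "G \<doteq> H \<longleftrightarrow> G \<succeq> H \<and> H \<succeq> G"

primrec conjugate :: "form \<Rightarrow> form" where
  "conjugate \<infinity> = -\<infinity>"
| "conjugate -\<infinity> = \<infinity>"
| "conjugate (Form L R) = Form (conjugate |`| R) (conjugate |`| L)"

definition is_check :: "form \<Rightarrow> bool" where
  "is_check G \<longleftrightarrow> G \<notin> {\<infinity>, -\<infinity>} \<and> (\<infinity> |\<in>| opts Left G \<or> -\<infinity> |\<in>| opts Right G)"

definition conway_form :: "form \<Rightarrow> bool" where
  "conway_form G \<longleftrightarrow> G \<in> Np - {\<infinity>, -\<infinity>} \<and> (\<forall>F. follower F G \<longrightarrow> \<not> is_check F)"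

definition conway_game :: "form \<Rightarrow> bool" where
  "conway_game G \<longleftrightarrow> G \<in> Np \<and> (\<exists>C. conway_form C \<and> G \<doteq> C)"

end

theory Submission
  imports Defs
begin

text \<open>For a Conway form \<open>C\<close>, winning strategies for Left moving second in \<open>G \<oplus> conjugate C\<close> and for
  Left in \<open>C \<oplus> X\<close> combine into one for \<open>G \<oplus> X\<close>: moves in \<open>conjugate C\<close> and \<open>C\<close> answer each other
  and cancel. This never breaks down at an atom, as Conway forms offer nobody an immediate win.
  Together with the mirror strategy on \<open>C \<oplus> conjugate C\<close> this settles Conway forms, and a Conway
  game can be replaced by a Conway form equal to it, because conjugation reverses the order.\<close>

abbreviation atoms :: "form set" where
  "atoms \<equiv> {\<infinity>, -\<infinity>}"

section \<open>Disjunctive sums\<close>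

lemma opponent_opponent [simp]: "opponent (opponent p) = p"
  by (cases p) auto

text \<open>The undefined sum of the two different atoms causes no exception: both orders evaluate
  to the same constant \<open>undefined\<close>.\<close>

lemma plus_form_commute: "G \<oplus> H = H \<oplus> G"
proof (induction G H rule: plus_form.induct)
  case (5 GL GR HL HR)
  have "(\<lambda>G'. G' \<oplus> Form HL HR) |`| GL = (\<lambda>G'. Form HL HR \<oplus> G') |`| GL"
    "(\<lambda>H'. Form GL GR \<oplus> H') |`| HL = (\<lambda>H'. H' \<oplus> Form GL GR) |`| HL"
    "(\<lambda>G'. G' \<oplus> Form HL HR) |`| GR = (\<lambda>G'. Form HL HR \<oplus> G') |`| GR"
    "(\<lambda>H'. Form GL GR \<oplus> H') |`| HR = (\<lambda>H'. H' \<oplus> Form GL GR) |`| HR"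
    using 5 by (auto intro!: fimage_cong)
  then show ?case by (simp add: sup_commute)
next
  case (1 X)
  then show ?case by (cases X) auto
next
  case (2 X)
  then show ?case by (cases X) auto
qed auto

lemma plus_form_Infs [simp]:
  "G \<noteq> -\<infinity> \<Longrightarrow> \<infinity> \<oplus> G = \<infinity>" "G \<noteq> -\<infinity> \<Longrightarrow> G \<oplus> \<infinity> = \<infinity>"
  "G \<noteq> \<infinity> \<Longrightarrow> -\<infinity> \<oplus> G = -\<infinity>" "G \<noteq> \<infinity> \<Longrightarrow> G \<oplus> -\<infinity> = -\<infinity>"
  by (cases G; simp)+

lemma wins_plus_form:
  assumes "G \<notin> atoms" "H \<notin> atoms"
  shows "wins p q (G \<oplus> H) \<longleftrightarrow>
    (if q = p
     then (\<exists>G' |\<in>| opts q G. wins p (opponent q) (G' \<oplus> H)) \<or>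
          (\<exists>H' |\<in>| opts q H. wins p (opponent q) (G \<oplus> H'))
     else (\<forall>G' |\<in>| opts q G. wins p (opponent q) (G' \<oplus> H)) \<and>
          (\<forall>H' |\<in>| opts q H. wins p (opponent q) (G \<oplus> H')))"
proof -
  obtain GL GR HL HR where "G = Form GL GR" "H = Form HL HR"
    using assms by (cases G; cases H) auto
  then show ?thesis
    by (cases q) auto
qed

section \<open>Conjugation\<close>

lemma conjugate_conjugate [simp]: "conjugate (conjugate G) = G"
proof (induction G)
  case (Form L R)
  have "conjugate |`| conjugate |`| L = L" "conjugate |`| conjugate |`| R = R"
    using Form by (force simp: fimage_iff)+
  then show ?case by simp
qed auto

lemma conjugate_eq_Inf_iff [simp]:
  "conjugate G = \<infinity> \<longleftrightarrow> G = -\<infinity>" "conjugate G = -\<infinity> \<longleftrightarrow> G = \<infinity>"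
  by (cases G; simp)+

lemma opts_conjugate: "opts p (conjugate G) = conjugate |`| opts (opponent p) G"
  by (cases p; cases G) auto

lemma conjugate_plus_form:
  assumes "{G, H} \<noteq> {\<infinity>, -\<infinity>}"
  shows "conjugate (G \<oplus> H) = conjugate G \<oplus> conjugate H"
  using assms
proof (induction G H rule: plus_form.induct)
  case (5 GL GR HL HR)
  \<comment> \<open>Each recursive sum has a non-atomic summand, so the undefined sum never arises
    and the induction hypotheses apply.\<close>
  have "{G', Form HL HR} \<noteq> atoms" "{Form GL GR, H'} \<noteq> atoms" for G' H'
    by auto
  then have
    "conjugate |`| (\<lambda>G'. G' \<oplus> Form HL HR) |`| GL
      = (\<lambda>G'. G' \<oplus> conjugate (Form HL HR)) |`| conjugate |`| GL"
    "conjugate |`| (\<lambda>H'. Form GL GR \<oplus> H') |`| HL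
      = (\<lambda>H'. conjugate (Form GL GR) \<oplus> H') |`| conjugate |`| HL"
    "conjugate |`| (\<lambda>G'. G' \<oplus> Form HL HR) |`| GR
      = (\<lambda>G'. G' \<oplus> conjugate (Form HL HR)) |`| conjugate |`| GR"
    "conjugate |`| (\<lambda>H'. Form GL GR \<oplus> H') |`| HR
      = (\<lambda>H'. conjugate (Form GL GR) \<oplus> H') |`| conjugate |`| HR"
    unfolding fset.map_comp comp_def using 5 by (auto intro!: fimage_cong)
  then show ?case by (simp add: fimage_funion)
qed auto

lemma wins_conjugate: "wins p q (conjugate G) \<longleftrightarrow> wins (opponent p) (opponent q) G"
proof (induction G arbitrary: p q)
  case (Form L R)
  then show ?case by (cases p; cases q) auto
next
  case PosInf
  then show ?case by (cases p) auto
next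
  case NegInf
  then show ?case by (cases p) auto
qed

lemma conjugate_in_Np: "G \<in> Np \<Longrightarrow> conjugate G \<in> Np"
  by (induction rule: Np.induct) (auto intro!: Np.intros)

section \<open>Outcomes and the order in terms of Left's wins\<close>

lemma wins_Right_iff: "wins Right q G \<longleftrightarrow> \<not> wins Left q G"
  using wins_determined[of Left q G] by simp

text \<open>The four outcomes correspond to the pairs of truth values for Left winning when moving
  first and when moving second; their order is the product order.\<close>

lemma outcome_le_iff:
  "outcome G \<le> outcome H \<longleftrightarrow> (\<forall>q. wins Left q G \<longrightarrow> wins Left q H)"
proof -
  have "(\<forall>q. wins Left q G \<longrightarrow> wins Left q H) \<longleftrightarrow>
    (wins Left Left G \<longrightarrow> wins Left Left H) \<and> (wins Left Right G \<longrightarrow> wins Left Right H)"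
    by (metis player.exhaust)
  then show ?thesis
    unfolding outcome_def less_eq_outcome_def wins_Right_iff by auto
qed

lemma outcome_in_OL_OP_iff: "outcome G \<in> {OL, OP} \<longleftrightarrow> wins Left Right G"
  by (auto simp: outcome_def wins_Right_iff)

lemma outcome_eq_OP_iff: "outcome G = OP \<longleftrightarrow> wins Left Right G \<and> wins Right Left G"
  by (auto simp: outcome_def wins_Right_iff)

lemma geq_form_iff:
  "G \<succeq> H \<longleftrightarrow> (\<forall>X \<in> Np - atoms. \<forall>q. wins Left q (H \<oplus> X) \<longrightarrow> wins Left q (G \<oplus> X))"
  by (simp add: geq_form_def outcome_le_iff)

lemma geq_form_trans: "G \<succeq> H \<Longrightarrow> H \<succeq> K \<Longrightarrow> G \<succeq> K"
  by (auto simp: geq_form_iff)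

lemma geq_form_conjugate:
  assumes "G \<succeq> H"
  shows "conjugate H \<succeq> conjugate G"
  unfolding geq_form_iff
proof (intro ballI allI impI)
  fix X q
  assume X: "X \<in> Np - atoms" and win: "wins Left q (conjugate G \<oplus> X)"
  \<comment> \<open>Exchanging the players moves the conjugation from \<open>K\<close> to
    \<open>X\<close> and turns a win for Left into a win for Right, which reverses the
    order.\<close>
  have conj: "wins Left q (conjugate K \<oplus> X) \<longleftrightarrow> \<not> wins Left (opponent q) (K \<oplus> conjugate X)" for K
  proof -
    have "conjugate (K \<oplus> conjugate X) = conjugate K \<oplus> X"
      using X by (subst conjugate_plus_form) (auto simp: doubleton_eq_iff)
    then show ?thesis
      by (metis opponent.simps(1) wins_Right_iff wins_conjugate)
  qed
  have "conjugate X \<in> Np - atoms"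
    using X by (auto simp: conjugate_in_Np)
  then show "wins Left q (conjugate H \<oplus> X)"
    using assms win unfolding conj geq_form_iff by blast
qed

section \<open>Conway forms and strategies on sums with them\<close>

lemma is_check_conjugate [simp]:
  "is_check (conjugate G) \<longleftrightarrow> is_check G"
proof -
  have "\<infinity> |\<in>| conjugate |`| A \<longleftrightarrow> -\<infinity> |\<in>| A" "-\<infinity> |\<in>| conjugate |`| A \<longleftrightarrow> \<infinity> |\<in>| A" for A
    by (metis conjugate.simps(1,2) conjugate_conjugate fimageE fimageI)+
  then show ?thesis
    by (auto simp: is_check_def opts_conjugate)
qed

lemma follower_conjugate: "follower F G \<Longrightarrow> follower (conjugate F) (conjugate G)"
proof (induction rule: follower.induct)
  case (option G' p G F)
  then have "conjugate G' |\<in>| opts (opponent p) (conjugate G)"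
    by (simp add: opts_conjugate)
  then show ?case using option.IH by (rule follower.option)
qed (rule follower.refl)

lemma conway_form_conjugate: "conway_form C \<Longrightarrow> conway_form (conjugate C)"
  unfolding conway_form_def
proof (intro conjI allI impI)
  assume C: "C \<in> Np - atoms \<and> (\<forall>F. follower F C \<longrightarrow> \<not> is_check F)"
  then show "conjugate C \<in> Np - atoms" by (simp add: conjugate_in_Np)
  fix F
  assume "follower F (conjugate C)"
  then have "follower (conjugate F) C"
    using follower_conjugate[of F "conjugate C"] by simp
  then show "\<not> is_check F"
    using C is_check_conjugate[of F] by blast
qed

lemma conway_form_opt:
  assumes "conway_form C" "C' |\<in>| opts p C" "C' \<notin> atoms"
  shows "conway_form C'"
proof -
  have "C' \<in> Np"
    using assms by (cases p) (auto simp: conway_form_def elim: Np.cases)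
  then show ?thesis
    using assms unfolding conway_form_def by (meson DiffI follower.option)
qed

text \<open>Atoms may still be options of a Conway form, but only those that lose for the mover:
  \<open>-\<infinity>\<close> for Left and \<open>\<infinity>\<close> for Right. This disposes of
  moves to atoms in the strategies below.\<close>

lemma conway_form_Infs:
  assumes "conway_form C"
  shows "C \<notin> atoms" "\<infinity> |\<notin>| opts Left C" "-\<infinity> |\<notin>| opts Right C"
  using assms follower.refl[of C] by (auto simp: conway_form_def is_check_def)

text \<open>Left mirrors: a move in one summand is answered by the conjugate move in the other,
  restoring the shape \<open>C' \<oplus> conjugate C'\<close>. If Right moves to an atom, it can
  only be \<open>\<infinity>\<close>, and Left has won.\<close>

lemma wins_plus_form_conjugate_self:
  "conway_form C \<Longrightarrow> wins Left Right (C \<oplus> conjugate C)"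
proof (induction "size C" arbitrary: C rule: less_induct)
  case less
  note C = conway_form_Infs[OF \<open>conway_form C\<close>]
  have reply: "wins Left Right (C' \<oplus> conjugate C')"
    if "C' |\<in>| opts p C" "C' \<notin> atoms" for p C'
    using less.hyps[OF size_opts conway_form_opt] less.prems that by blast
  have "wins Left Left (C' \<oplus> conjugate C)" if opt: "C' |\<in>| opts Right C" for C'
  proof (cases "C' \<in> atoms")
    case True
    then show ?thesis using C opt by auto
  next
    case False
    have "conjugate C' |\<in>| opts Left (conjugate C)"
      using opt by (simp add: opts_conjugate)
    then show ?thesis
      using reply[OF opt False] False C by (subst wins_plus_form) auto
  qed
  moreover have "wins Left Left (C \<oplus> conjugate C')" if opt: "C' |\<in>| opts Left C" for C'
  proof (cases "C' \<in> atoms")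
    case True
    then show ?thesis using C opt by auto
  next
    case False
    then show ?thesis
      using reply[OF opt False] opt C by (subst wins_plus_form) auto
  qed
  ultimately show ?case
    using C by (subst wins_plus_form) (auto simp: opts_conjugate)
qed

text \<open>The three implications need each other. A move by Right in \<open>G\<close> leads from
  the first to the third, one in \<open>X\<close> from the first to the second; Left's winning moves
  in \<open>X\<close> or \<open>G\<close> lead back to the first.\<close>

lemma wins_plus_form_cancel:
  assumes "conway_form C" "G \<notin> atoms" "X \<notin> atoms"
  shows "(wins Left Right (G \<oplus> conjugate C) \<longrightarrow> wins Left Right (C \<oplus> X) \<longrightarrow> wins Left Right (G \<oplus> X)) \<and>
    (wins Left Right (G \<oplus> conjugate C) \<longrightarrow> wins Left Left (C \<oplus> X) \<longrightarrow> wins Left Left (G \<oplus> X)) \<and>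
    (wins Left Left (G \<oplus> conjugate C) \<longrightarrow> wins Left Right (C \<oplus> X) \<longrightarrow> wins Left Left (G \<oplus> X))"
  using assms
proof (induction "size G + size C + size X" arbitrary: G C X rule: less_induct)
  case less
  note C = conway_form_Infs[OF \<open>conway_form C\<close>]
  note G = \<open>G \<notin> atoms\<close> and X = \<open>X \<notin> atoms\<close>
  have C': "conjugate C \<notin> atoms" using C by auto
  note GC = wins_plus_form[OF G C'] and CX = wins_plus_form[OF C(1) X]
    and GX = wins_plus_form[OF G X]
  note IH_G = less.hyps[OF _ \<open>conway_form C\<close> _ X] and IH_X = less.hyps[OF _ \<open>conway_form C\<close> G]
    and IH_C = less.hyps[OF _ _ G X]
  show ?case
  proof (intro conjI impI)
    assume 1: "wins Left Right (G \<oplus> conjugate C)" and 2: "wins Left Right (C \<oplus> X)"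
    have "wins Left Left (G' \<oplus> X)" if opt: "G' |\<in>| opts Right G" for G'
    proof (cases "G' \<in> atoms")
      \<comment> \<open>\<open>G'\<close> must be \<open>\<infinity>\<close>: a move to
        \<open>-\<infinity>\<close> would also refute Left's win in
        \<open>G \<oplus> conjugate C\<close>.\<close>
      case True
      then show ?thesis using 1 opt C X unfolding GC by auto
    next
      case False
      then show ?thesis
        using 1 2 opt IH_G[of G'] size_opts[OF opt] unfolding GC by auto
    qed
    moreover have "wins Left Left (G \<oplus> X')" if opt: "X' |\<in>| opts Right X" for X'
    proof (cases "X' \<in> atoms")
      case True
      then show ?thesis using 2 opt C G unfolding CX by auto
    next
      case False
      then show ?thesis
        using 1 2 opt IH_X[of X'] size_opts[OF opt] unfolding CX by auto
    qed
    ultimately show "wins Left Right (G \<oplus> X)" unfolding GX by auto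
  next
    assume 1: "wins Left Right (G \<oplus> conjugate C)" and "wins Left Left (C \<oplus> X)"
    then consider (X) X' where "X' |\<in>| opts Left X" "wins Left Right (C \<oplus> X')"
      | (C) C' where "C' |\<in>| opts Left C" "wins Left Right (C' \<oplus> X)"
      unfolding CX by auto
    then show "wins Left Left (G \<oplus> X)"
    proof cases
      case X
      have "wins Left Right (G \<oplus> X')"
      proof (cases "X' \<in> atoms")
        case True
        then show ?thesis using X C G by auto
      next
        case False
        then show ?thesis using 1 X IH_X[of X'] size_opts[OF X(1)] by auto
      qed
      then show ?thesis using X unfolding GX by auto
    next
      \<comment> \<open>The move to \<open>C'\<close> is fed to the other sum as Right's move to
        \<open>conjugate C'\<close>. Nothing is played in \<open>G \<oplus> X\<close>; only
        \<open>C\<close> shrinks, which is why its size counts in the measure.\<close>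
      case C: C
      \<comment> \<open>\<open>\<infinity>\<close> is excluded as \<open>C\<close> is no check,
        \<open>-\<infinity>\<close> because Left wins \<open>C' \<oplus> X\<close>.\<close>
      have "C' \<notin> atoms" using C conway_form_Infs[OF \<open>conway_form C\<close>] X by auto
      moreover have "wins Left Left (G \<oplus> conjugate C')"
        using 1 C(1) unfolding GC by (auto simp: opts_conjugate)
      ultimately show ?thesis
        using C IH_C[of C'] size_opts[OF C(1)] conway_form_opt[OF \<open>conway_form C\<close> C(1)] by auto
    qed
  next
    assume "wins Left Left (G \<oplus> conjugate C)" and 2: "wins Left Right (C \<oplus> X)"
    then consider (G) G' where "G' |\<in>| opts Left G" "wins Left Right (G' \<oplus> conjugate C)"
      | (C) C' where "C' |\<in>| opts Right C" "wins Left Right (G \<oplus> conjugate C')"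
      unfolding GC by (auto simp: opts_conjugate)
    then show "wins Left Left (G \<oplus> X)"
    proof cases
      case G
      have "wins Left Right (G' \<oplus> X)"
      proof (cases "G' \<in> atoms")
        case True
        then show ?thesis using G C X by auto
      next
        case False
        then show ?thesis using 2 G IH_G[of G'] size_opts[OF G(1)] by auto
      qed
      then show ?thesis using G unfolding GX by auto
    next
      case C: C
      have "C' \<notin> atoms" using C conway_form_Infs[OF \<open>conway_form C\<close>] G by auto
      moreover have "wins Left Left (C' \<oplus> X)"
        using 2 C(1) unfolding CX by auto
      ultimately show ?thesis
        using C IH_C[of C'] size_opts[OF C(1)] conway_form_opt[OF \<open>conway_form C\<close> C(1)] by auto
    qed
  qed
qed

section \<open>Comparison with a Conway form\<close>

lemma geq_conway_form_iff:
  assumes "conway_form C" "G \<notin> atoms"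
  shows "G \<succeq> C \<longleftrightarrow> wins Left Right (G \<oplus> conjugate C)"
proof
  assume "G \<succeq> C"
  \<comment> \<open>\<open>conjugate C\<close> serves as the test position: the mirror strategy wins
    \<open>C \<oplus> conjugate C\<close>.\<close>
  moreover have "conjugate C \<in> Np - atoms"
    using conway_form_conjugate[OF assms(1)] by (simp add: conway_form_def)
  ultimately show "wins Left Right (G \<oplus> conjugate C)"
    using wins_plus_form_conjugate_self[OF assms(1)] by (auto simp: geq_form_iff)
next
  assume win: "wins Left Right (G \<oplus> conjugate C)"
  show "G \<succeq> C"
    unfolding geq_form_iff
  proof (intro ballI allI impI)
    fix X q
    assume "X \<in> Np - atoms" "wins Left q (C \<oplus> X)"
    then show "wins Left q (G \<oplus> X)"
      using wins_plus_form_cancel[OF assms, of X] win by (cases q) auto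
  qed
qed

text \<open>Conjugation reverses the order and exchanges the players, reducing this to the previous
  lemma for the Conway form \<open>conjugate C\<close>.\<close>

lemma conway_form_geq_iff:
  assumes "conway_form C" "G \<notin> atoms"
  shows "C \<succeq> G \<longleftrightarrow> wins Right Left (G \<oplus> conjugate C)"
proof -
  have "C \<succeq> G \<longleftrightarrow> conjugate G \<succeq> conjugate C"
    by (metis conjugate_conjugate geq_form_conjugate)
  also have "\<dots> \<longleftrightarrow> wins Left Right (conjugate G \<oplus> conjugate (conjugate C))"
    using assms by (intro geq_conway_form_iff conway_form_conjugate) auto
  also have "conjugate G \<oplus> conjugate (conjugate C) = conjugate (G \<oplus> conjugate C)"
    using assms by (subst conjugate_plus_form) auto
  finally show ?thesis by (simp add: wins_conjugate)
qed

lemma not_NegInf_geq_conway_form: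
  assumes "conway_form C"
  shows "\<not> -\<infinity> \<succeq> C"
proof
  \<comment> \<open>In \<open>C \<oplus> ?X\<close> Left moves to \<open>\<infinity>\<close> at
    once, whereas \<open>-\<infinity> \<oplus> ?X\<close> is already lost.\<close>
  let ?X = "Form {|\<infinity>|} {|\<infinity>|}"
  note C = conway_form_Infs[OF assms]
  have X: "?X \<in> Np - atoms" by (auto intro!: Np.intros)
  have "wins Left Left (C \<oplus> ?X)"
    using C by (subst wins_plus_form) auto
  moreover assume "-\<infinity> \<succeq> C"
  ultimately have "wins Left Left (-\<infinity> \<oplus> ?X)"
    using X unfolding geq_form_iff by blast
  then show False by simp
qed

lemma not_conway_form_geq_PosInf: "conway_form C \<Longrightarrow> \<not> C \<succeq> \<infinity>"
  using geq_form_conjugate[of C "\<infinity>"] not_NegInf_geq_conway_form[OF conway_form_conjugate] by auto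

lemma PosInf_geq: "\<infinity> \<succeq> G"
  by (auto simp: geq_form_iff)

theorem theorem2p14:
  fixes G H :: form
  assumes "G \<in> Np" and "H \<in> Np" and "conway_game H"
  shows "(G \<succeq> H \<longleftrightarrow> outcome (G \<oplus> conjugate H) \<in> {OL, OP}) \<and>
         (G \<doteq> H \<longleftrightarrow> outcome (G \<oplus> conjugate H) = OP)"
proof -
  obtain C where C: "conway_form C" and HC: "H \<succeq> C" "C \<succeq> H"
    using assms(3) by (auto simp: conway_game_def eq_form_def)
  have geq: "G \<succeq> H \<longleftrightarrow> G \<succeq> C" "H \<succeq> G \<longleftrightarrow> C \<succeq> G"
    using HC geq_form_trans by blast+
  have H: "H \<notin> atoms"
    using HC not_NegInf_geq_conway_form[OF C] not_conway_form_geq_PosInf[OF C] by auto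
  show ?thesis
  proof (cases "G \<in> atoms")
    \<comment> \<open>As \<open>H\<close> is not an atom, the sum is \<open>G\<close> itself, with
      outcome \<open>OL\<close> or \<open>OR\<close>.\<close>
    case True
    then show ?thesis
      using H not_NegInf_geq_conway_form[OF C] not_conway_form_geq_PosInf[OF C] PosInf_geq
      unfolding outcome_in_OL_OP_iff outcome_eq_OP_iff eq_form_def geq by auto
  next
    case False
    \<comment> \<open>\<open>conjugate H\<close> and \<open>conjugate C\<close> are equal as games,
      and the non-atomic \<open>G\<close> is itself a legitimate test position for them.\<close>
    then have "wins Left q (conjugate H \<oplus> G) \<longleftrightarrow> wins Left q (conjugate C \<oplus> G)" for q
      using geq_form_conjugate[OF HC(1)] geq_form_conjugate[OF HC(2)] assms(1)
      unfolding geq_form_iff by blast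
    then have "wins p q (G \<oplus> conjugate H) \<longleftrightarrow> wins p q (G \<oplus> conjugate C)" for p q
      by (cases p) (simp_all add: plus_form_commute[of G] wins_Right_iff)
    then show ?thesis
      unfolding outcome_in_OL_OP_iff outcome_eq_OP_iff eq_form_def geq
      using geq_conway_form_iff[OF C False] conway_form_geq_iff[OF C False] by simp
  qed
qed

end
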